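(* Every Hilbert left $\mathbb{O}$-module $H$ admits a weak associative orthonormal basis. More precisely, if $\{x_\alpha\}_{\alpha\in\Lambda}$ is an orthonormal basis of the real Hilbert space $(\mathscr{A}(H),\operatorname{Re}\langle\cdot,\cdot\rangle)$ and $\{x_\beta\}_{\beta\in\Lambda'}$ is an orthonormal basis of the real Hilbert space $(\mathscr{A}^{-}(H),\operatorname{Re}\langle\cdot,\cdot\rangle)$ (with $\Lambda$ and $\Lambda'$ disjoint index sets), then $S:=\{x_\gamma\}_{\gamma\in\Lambda\cup\Lambda'}$ is a weak associative orthonormal basis of $H$.
   Context: $\mathbb{O}$ is the real algebra of octonions, with conjugation $x\mapsto\overline{x}$ and real part $\operatorname{Re}x=\tfrac12(x+\overline{x})$. A left $\mathbb{O}$-module is a real vector space $M$ with an $\mathbb{R}$-linear map $L:\mathbb{O}\to\operatorname{End}_{\mathbb{R}}(M)$, written $px:=L_p(x)$, such that $1x=x$ and $[p,q,x]=-[q,p,x]$ for all $p,q\in\mathbb{O}$, $x\in M$, where $[p,q,x]:=(pq)x-p(qx)$ (equivalently $p(px)=p^2x$ for all $p,x$). Set $\mathscr{A}(M):=\{m\in M: (pq)m=p(qm)\ \text{for all } p,q\in\mathbb{O}\}$ and $\mathscr{A}^{-}(M):=\{m\in M: (pq)m=q(pm)\ \text{for all } p,q\in\mathbb{O}\}$. A Hilbert left $\mathbb{O}$-module (or $\mathbb{O}$-Hilbert space) is a left $\mathbb{O}$-module $H$ with an $\mathbb{R}$-bilinear map $\langle\cdot,\cdot\rangle:H\times H\to\mathbb{O}$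 such that for all $u,v\in H$, $p\in\mathbb{O}$: (1) $\operatorname{Re}(\langle pu,v\rangle-p\langle u,v\rangle)=0$; (2) $\langle u,v\rangle=\overline{\langle v,u\rangle}$; (3) $\langle u,u\rangle\in[0,\infty)$, and $\langle u,u\rangle=0$ iff $u=0$; and $H$ is complete for the norm $\|u\|=\sqrt{\langle u,u\rangle}$. The second associator is $[p,u,v]:=\langle pu,v\rangle-p\langle u,v\rangle$ for $p\in\mathbb{O}$, $u,v\in H$. A subset $S=\{x_\gamma\}\subseteq H$ is an orthonormal system of $H$ if $\langle x_\gamma,x_{\gamma'}\rangle=\delta_{\gamma\gamma'}$ for all $\gamma,\gamma'$; it is an orthonormal basis of $H$ if it is an orthonormal system not properly contained in any other orthonormal system. An orthonormal basis $S$ is weak associative if $[p,x_\gamma,x_{\gamma'}]=0$ for all $p\in\mathbb{O}$ and all $\gamma,\gamma'$. *)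

theory Defs
  imports "HOL-Analysis.Analysis"
begin

text \<open>The octonion with components \<open>oc0, \<dots>, oc7\<close> is
  \<open>oc0 + oc1 e\<^sub>1 + \<dots> + oc7 e\<^sub>7\<close>.\<close>

datatype octonion =
  Octonion (oc0: real) (oc1: real) (oc2: real) (oc3: real)
    (oc4: real) (oc5: real) (oc6: real) (oc7: real)

lemma octonion_eq_iff:
  "x = y \<longleftrightarrow> oc0 x = oc0 y \<and> oc1 x = oc1 y \<and> oc2 x = oc2 y \<and> oc3 x = oc3 y
    \<and> oc4 x = oc4 y \<and> oc5 x = oc5 y \<and> oc6 x = oc6 y \<and> oc7 x = oc7 y"
  by (cases x; cases y) simp

instantiation octonion :: real_vector
begin

definition zero_octonion where
  "zero_octonion = Octonion 0 0 0 0 0 0 0 0"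

definition plus_octonion where
  "x + y = Octonion (oc0 x + oc0 y) (oc1 x + oc1 y) (oc2 x + oc2 y) (oc3 x + oc3 y)
      (oc4 x + oc4 y) (oc5 x + oc5 y) (oc6 x + oc6 y) (oc7 x + oc7 y)"

definition minus_octonion where
  "x - y = Octonion (oc0 x - oc0 y) (oc1 x - oc1 y) (oc2 x - oc2 y) (oc3 x - oc3 y)
      (oc4 x - oc4 y) (oc5 x - oc5 y) (oc6 x - oc6 y) (oc7 x - oc7 y)"

definition uminus_octonion where
  "- x = Octonion (- oc0 x) (- oc1 x) (- oc2 x) (- oc3 x) (- oc4 x) (- oc5 x) (- oc6 x) (- oc7 x)"

definition scaleR_octonion where
  "r *\<^sub>R x = Octonion (r * oc0 x) (r * oc1 x) (r * oc2 x) (r * oc3 x)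
      (r * oc4 x) (r * oc5 x) (r * oc6 x) (r * oc7 x)"

instance
  by standard
    (simp_all add: octonion_eq_iff zero_octonion_def plus_octonion_def minus_octonion_def
      uminus_octonion_def scaleR_octonion_def algebra_simps)

end

text \<open>The product is the bilinear one for which \<open>1\<close> is neutral, \<open>e\<^sub>i e\<^sub>i = -1\<close>, distinct
  \<open>e\<^sub>i, e\<^sub>j\<close> anticommute, and \<open>e\<^sub>i e\<^sub>j = e\<^sub>k\<close> whenever \<open>(i,j,k)\<close> is a cyclic permutation of
  one of the Fano triples \<open>(i, i+1, i+3)\<close> (indices modulo 7):
  (1,2,4), (2,3,5), (3,4,6), (4,5,7), (5,6,1), (6,7,2), (7,1,3).
  The octonions do not form an instance of any ring class, since the product is not associative.\<close>

instantiation octonion :: "{times, zero_neq_one}"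
begin

definition one_octonion where
  "one_octonion = Octonion 1 0 0 0 0 0 0 0"

definition times_octonion where
  "x * y = Octonion
      (oc0 x * oc0 y - oc1 x * oc1 y - oc2 x * oc2 y - oc3 x * oc3 y
        - oc4 x * oc4 y - oc5 x * oc5 y - oc6 x * oc6 y - oc7 x * oc7 y)
      (oc0 x * oc1 y + oc1 x * oc0 y + oc2 x * oc4 y - oc4 x * oc2 y
        + oc5 x * oc6 y - oc6 x * oc5 y + oc3 x * oc7 y - oc7 x * oc3 y)
      (oc0 x * oc2 y + oc2 x * oc0 y + oc4 x * oc1 y - oc1 x * oc4 y
        + oc3 x * oc5 y - oc5 x * oc3 y + oc6 x * oc7 y - oc7 x * oc6 y)
      (oc0 x * oc3 y + oc3 x * oc0 y + oc5 x * oc2 y - oc2 x * oc5 y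
        + oc4 x * oc6 y - oc6 x * oc4 y + oc7 x * oc1 y - oc1 x * oc7 y)
      (oc0 x * oc4 y + oc4 x * oc0 y + oc1 x * oc2 y - oc2 x * oc1 y
        + oc6 x * oc3 y - oc3 x * oc6 y + oc5 x * oc7 y - oc7 x * oc5 y)
      (oc0 x * oc5 y + oc5 x * oc0 y + oc2 x * oc3 y - oc3 x * oc2 y
        + oc7 x * oc4 y - oc4 x * oc7 y + oc6 x * oc1 y - oc1 x * oc6 y)
      (oc0 x * oc6 y + oc6 x * oc0 y + oc3 x * oc4 y - oc4 x * oc3 y
        + oc1 x * oc5 y - oc5 x * oc1 y + oc7 x * oc2 y - oc2 x * oc7 y)
      (oc0 x * oc7 y + oc7 x * oc0 y + oc4 x * oc5 y - oc5 x * oc4 y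
        + oc2 x * oc6 y - oc6 x * oc2 y + oc1 x * oc3 y - oc3 x * oc1 y)"

instance
  by standard (simp add: one_octonion_def zero_octonion_def)

end

definition oct_cnj :: "octonion \<Rightarrow> octonion" where
  "oct_cnj x = Octonion (oc0 x) (- oc1 x) (- oc2 x) (- oc3 x)
      (- oc4 x) (- oc5 x) (- oc6 x) (- oc7 x)"

text \<open>The real part is taken as an element of \<open>real\<close>; a real number \<open>r\<close> is identified with the
  octonion \<open>r *\<^sub>R 1\<close>.\<close>

definition oct_Re :: "octonion \<Rightarrow> real" where
  "oct_Re x = oc0 x"

lemmas octonion_defs = octonion_eq_iff zero_octonion_def plus_octonion_def minus_octonion_def
  uminus_octonion_def scaleR_octonion_def one_octonion_def times_octonion_def oct_cnj_def
  oct_Re_def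

lemma oct_Re_conv_cnj: "oct_Re x *\<^sub>R 1 = (1/2) *\<^sub>R (x + oct_cnj x)"
  by (simp add: octonion_defs)

text \<open>By the following facts the type is an 8-dimensional unital composition algebra with
  positive definite norm form, that is, the algebra of octonions.\<close>

lemma bilinear_times_octonion: "bilinear ((*) :: octonion \<Rightarrow> octonion \<Rightarrow> octonion)"
  unfolding bilinear_def by (intro conjI allI linearI; simp add: octonion_defs algebra_simps)

lemma octonion_one_times: "1 * x = x" "x * 1 = x" for x :: octonion
  by (simp_all add: octonion_defs)

lemma octonion_times_cnj:
  "x * oct_cnj x = ((oc0 x)\<^sup>2 + (oc1 x)\<^sup>2 + (oc2 x)\<^sup>2 + (oc3 x)\<^sup>2
    + (oc4 x)\<^sup>2 + (oc5 x)\<^sup>2 + (oc6 x)\<^sup>2 + (oc7 x)\<^sup>2) *\<^sub>R 1"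
  by (simp add: octonion_defs power2_eq_square)

lemma oct_cnj_times: "oct_cnj (x * y) = oct_cnj y * oct_cnj x"
  by (simp add: octonion_defs algebra_simps)

lemma octonion_norm_times:
  "oct_Re ((x * y) * oct_cnj (x * y)) = oct_Re (x * oct_cnj x) * oct_Re (y * oct_cnj y)"
  unfolding octonion_times_cnj
  by (simp only: oct_Re_def scaleR_octonion_def one_octonion_def times_octonion_def octonion.sel
      mult_1_right) algebra

definition module_associator ::
  "(octonion \<Rightarrow> 'a \<Rightarrow> 'a) \<Rightarrow> octonion \<Rightarrow> octonion \<Rightarrow> 'a \<Rightarrow> 'a::real_vector" where
  "module_associator act p q x = act (p * q) x - act p (act q x)"

locale left_octonion_module =
  fixes act :: "octonion \<Rightarrow> 'a::real_vector \<Rightarrow> 'a"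
  assumes bilinear_act: "bilinear act"
    and act_one: "act 1 x = x"
    and module_associator_swap: "module_associator act p q x = - module_associator act q p x"

definition associative_elements :: "(octonion \<Rightarrow> 'a \<Rightarrow> 'a) \<Rightarrow> 'a set" where
  "associative_elements act = {m. \<forall>p q. act (p * q) m = act p (act q m)}"

definition conjugate_associative_elements :: "(octonion \<Rightarrow> 'a \<Rightarrow> 'a) \<Rightarrow> 'a set" where
  "conjugate_associative_elements act = {m. \<forall>p q. act (p * q) m = act q (act p m)}"

definition second_associator ::
  "(octonion \<Rightarrow> 'a \<Rightarrow> 'a) \<Rightarrow> ('a \<Rightarrow> 'a \<Rightarrow> octonion) \<Rightarrow> octonion \<Rightarrow> 'a \<Rightarrow> 'a \<Rightarrow> octonion" where
  "second_associator act ip p u v = ip (act p u) v - p * ip u v"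

definition ip_norm :: "('a \<Rightarrow> 'a \<Rightarrow> octonion) \<Rightarrow> 'a \<Rightarrow> real" where
  "ip_norm ip u = sqrt (oct_Re (ip u u))"

locale hilbert_octonion_module = left_octonion_module act
  for act :: "octonion \<Rightarrow> 'a::real_vector \<Rightarrow> 'a" +
  fixes ip :: "'a \<Rightarrow> 'a \<Rightarrow> octonion"
  assumes bilinear_ip: "bilinear ip"
    and Re_second_associator: "oct_Re (second_associator act ip p u v) = 0"
    and ip_cnj: "ip u v = oct_cnj (ip v u)"
    and ip_self_nonneg: "\<exists>r\<ge>0. ip u u = r *\<^sub>R 1"
    and ip_self_eq_0_iff: "ip u u = 0 \<longleftrightarrow> u = 0"
    and complete:
      "\<And>X :: nat \<Rightarrow> 'a. (\<forall>e>0. \<exists>N. \<forall>m\<ge>N. \<forall>n\<ge>N. ip_norm ip (X m - X n) < e)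
        \<Longrightarrow> \<exists>l. (\<lambda>n. ip_norm ip (X n - l)) \<longlonglongrightarrow> 0"

text \<open>Orthonormal systems are families \<open>x\<close> indexed by a set \<open>I\<close>; a subset \<open>S\<close> of the space is the
  family \<open>\<lambda>u. u\<close> indexed by \<open>S\<close>. The carrier \<open>V\<close> and the codomain of the inner product vary so that
  the same notions apply to the octonionic space and to its real subspaces.\<close>

definition orthonormal_system ::
  "'a set \<Rightarrow> ('a \<Rightarrow> 'a \<Rightarrow> 'b::zero_neq_one) \<Rightarrow> 'i set \<Rightarrow> ('i \<Rightarrow> 'a) \<Rightarrow> bool" where
  "orthonormal_system V ip I x \<longleftrightarrow>
    x ` I \<subseteq> V \<and> (\<forall>i\<in>I. \<forall>j\<in>I. ip (x i) (x j) = (if i = j then 1 else 0))"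

definition orthonormal_basis ::
  "'a set \<Rightarrow> ('a \<Rightarrow> 'a \<Rightarrow> 'b::zero_neq_one) \<Rightarrow> 'i set \<Rightarrow> ('i \<Rightarrow> 'a) \<Rightarrow> bool" where
  "orthonormal_basis V ip I x \<longleftrightarrow>
    orthonormal_system V ip I x \<and>
    \<not> (\<exists>T. orthonormal_system V ip T (\<lambda>u. u) \<and> x ` I \<subset> T)"

definition weak_associative_orthonormal_basis ::
  "(octonion \<Rightarrow> 'a \<Rightarrow> 'a) \<Rightarrow> ('a \<Rightarrow> 'a \<Rightarrow> octonion) \<Rightarrow> 'i set \<Rightarrow> ('i \<Rightarrow> 'a) \<Rightarrow> bool" where
  "weak_associative_orthonormal_basis act ip I x \<longleftrightarrow>
    orthonormal_basis UNIV ip I x \<and>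
    (\<forall>p. \<forall>i\<in>I. \<forall>j\<in>I. second_associator act ip p (x i) (x j) = 0)"

end

theory Submission
  imports Defs
begin

text \<open>With respect to \<open>Re \<langle>u, v\<rangle>\<close> the adjoint of \<open>p\<close> acts as \<open>cnj p\<close>. Moving octonions from one
  argument to the other shows that \<open>\<langle>u, v\<rangle>\<close> is real if \<open>u\<close> and \<open>v\<close> are both associative or both
  conjugate associative, and zero in the mixed case. Hence the union of the two real bases is an
  octonionic orthonormal system with vanishing second associators.

  For maximality, the octonionic orthogonal complement of this system is a submodule. The imaginary
  units \<open>e\<^sub>1, \<dots>, e\<^sub>7\<close> act as Clifford generators, and a vector is associative if it is a
  \<open>-1\<close>-eigenvector of \<open>e\<^sub>1 \<dots> e\<^sub>7\<close> and of the three involutions \<open>e\<^sub>1 e\<^sub>2 e\<^sub>4\<close>, \<open>e\<^sub>2 e\<^sub>3 e\<^sub>5\<close>,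
  \<open>e\<^sub>3 e\<^sub>4 e\<^sub>6\<close>. The central involution \<open>e\<^sub>1 \<dots> e\<^sub>7\<close> has an eigenvector in every nonzero submodule.
  If its sign is \<open>-1\<close>, the signs of the other three can be corrected one by one, by applying a unit
  that anticommutes with that involution and commutes with those already treated; the sign \<open>+1\<close> is
  the same case for the module on which \<open>p\<close> acts as \<open>cnj p\<close>. So a nonzero submodule contains a
  nonzero associative or conjugate associative vector, which maximality of the real bases excludes
  for the complement.\<close>

section \<open>Imaginary units and linear algebra over them\<close>

definition imag_unit :: "nat \<Rightarrow> octonion" where
  "imag_unit k = Octonion 0 (of_bool (k = 1)) (of_bool (k = 2)) (of_bool (k = 3)) (of_bool (k = 4))
    (of_bool (k = 5)) (of_bool (k = 6)) (of_bool (k = 7))"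

lemma octonion_decomp:
  "p = oc0 p *\<^sub>R 1 + oc1 p *\<^sub>R imag_unit 1 + oc2 p *\<^sub>R imag_unit 2 + oc3 p *\<^sub>R imag_unit 3
    + oc4 p *\<^sub>R imag_unit 4 + oc5 p *\<^sub>R imag_unit 5 + oc6 p *\<^sub>R imag_unit 6 + oc7 p *\<^sub>R imag_unit 7"
  by (simp add: octonion_defs imag_unit_def)

lemma imag_unit_square:
  assumes "1 \<le> k" "k \<le> 7"
  shows "imag_unit k * imag_unit k = - 1"
proof -
  have "k \<in> {1, 2, 3, 4, 5, 6, 7}" using assms by auto
  then show ?thesis by (auto simp: octonion_defs imag_unit_def)
qed

text \<open>An index outside 1..7 gives the octonion 0, so the sign rule holds for all
  \<open>i < j\<close>.\<close>

lemma imag_unit_anticommute: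
  assumes "i < j"
  shows "imag_unit j * imag_unit i = - (imag_unit i * imag_unit j)"
  using assms by (simp add: octonion_defs imag_unit_def)

lemma imag_unit_times:
  "imag_unit 1 * imag_unit 2 = imag_unit 4" "imag_unit 1 * imag_unit 3 = imag_unit 7"
    "imag_unit 1 * imag_unit 4 = - imag_unit 2" "imag_unit 1 * imag_unit 5 = imag_unit 6"
    "imag_unit 1 * imag_unit 6 = - imag_unit 5" "imag_unit 1 * imag_unit 7 = - imag_unit 3"
    "imag_unit 2 * imag_unit 3 = imag_unit 5" "imag_unit 2 * imag_unit 4 = imag_unit 1"
    "imag_unit 2 * imag_unit 5 = - imag_unit 3" "imag_unit 2 * imag_unit 6 = imag_unit 7"
    "imag_unit 2 * imag_unit 7 = - imag_unit 6" "imag_unit 3 * imag_unit 4 = imag_unit 6"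
    "imag_unit 3 * imag_unit 5 = imag_unit 2" "imag_unit 3 * imag_unit 6 = - imag_unit 4"
    "imag_unit 3 * imag_unit 7 = imag_unit 1" "imag_unit 4 * imag_unit 5 = imag_unit 7"
    "imag_unit 4 * imag_unit 6 = imag_unit 3" "imag_unit 4 * imag_unit 7 = - imag_unit 5"
    "imag_unit 5 * imag_unit 6 = imag_unit 1" "imag_unit 5 * imag_unit 7 = imag_unit 4"
    "imag_unit 6 * imag_unit 7 = imag_unit 2"
  by (simp_all add: octonion_defs imag_unit_def)

lemma oct_cnj_cnj [simp]: "oct_cnj (oct_cnj p) = p"
  by (simp add: octonion_defs)

lemma oct_cnj_imag_unit: "oct_cnj (imag_unit k) = - imag_unit k"
  by (simp add: octonion_defs imag_unit_def)

lemma oct_cnj_one: "oct_cnj 1 = 1"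
  by (simp add: octonion_defs)

lemma oct_Re_cnj [simp]: "oct_Re (oct_cnj p) = oct_Re p"
  by (simp add: octonion_defs)

lemma linear_oct_cnj: "linear oct_cnj"
  by (rule linearI; simp add: octonion_defs)

lemma linear_oct_Re: "linear oct_Re"
  by (rule linearI; simp add: octonion_defs)

text \<open>The form Re(pq) is nondegenerate: 1 and the seven units read off the components of
  \<open>q\<close> up to sign. Octonionic identities thus reduce to real parts, where adjoints can
  be used.\<close>

lemma octonion_eq_if_Re_times_eq:
  assumes "\<And>p. oct_Re (p * q) = oct_Re (p * r)"
  shows "q = r"
  using assms[of 1] assms[of "imag_unit 1"] assms[of "imag_unit 2"] assms[of "imag_unit 3"]
    assms[of "imag_unit 4"] assms[of "imag_unit 5"] assms[of "imag_unit 6"] assms[of "imag_unit 7"]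
  by (simp add: octonion_defs imag_unit_def)

lemma linear_octonion_eqI:
  assumes "linear f" "linear g" "f 1 = g 1" "\<And>k. k \<in> {1..7} \<Longrightarrow> f (imag_unit k) = g (imag_unit k)"
  shows "f p = g p"
  by (subst (1 2) octonion_decomp[of p])
    (simp add: assms(3,4) assms(1,2)[THEN linear_add] assms(1,2)[THEN linear_scale])

text \<open>If \<open>T y = y\<close>, then \<open>E y\<close> is an eigenvector because
  \<open>E\<close> reverses the sign; otherwise \<open>y - T y\<close> is one.\<close>

lemma involution_eigenvector:
  assumes "subspace W" "linear T" "linear E"
    and T: "\<And>z. z \<in> W \<Longrightarrow> T z \<in> W" "\<And>z. z \<in> W \<Longrightarrow> T (T z) = z"
    and E: "\<And>z. z \<in> W \<Longrightarrow> E z \<in> W" "\<And>z. z \<in> W \<Longrightarrow> E z = 0 \<Longrightarrow> z = 0"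
      "\<And>z. z \<in> W \<Longrightarrow> T (E z) = - E (T z)"
    and y: "y \<in> W" "y \<noteq> 0"
  shows "\<exists>z\<in>W. z \<noteq> 0 \<and> T z = - z"
proof (cases "T y = y")
  case True
  then show ?thesis using E(1,2)[OF y(1)] E(3)[OF y(1)] y(2) by (intro bexI[of _ "E y"]) auto
next
  case False
  have "y - T y \<in> W" using assms by (simp add: subspace_diff)
  moreover have "T (y - T y) = - (y - T y)"
    using T y by (simp add: linear_diff[OF \<open>linear T\<close>])
  ultimately show ?thesis using False by (intro bexI[of _ "y - T y"]) auto
qed

section \<open>Clifford relations of the units and a criterion for associative vectors\<close>

context left_octonion_module
begin

lemmas act_simps =
  bilinear_ladd[OF bilinear_act] bilinear_radd[OF bilinear_act]
  bilinear_lsub[OF bilinear_act] bilinear_rsub[OF bilinear_act]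
  bilinear_lneg[OF bilinear_act] bilinear_rneg[OF bilinear_act]
  bilinear_lmul[OF bilinear_act] bilinear_rmul[OF bilinear_act]
  bilinear_lzero[OF bilinear_act] bilinear_rzero[OF bilinear_act]
  act_one

lemma linear_act: "linear (act p)"
  using bilinear_act by (simp add: bilinear_def)

text \<open>Antisymmetry of the associator means that the action respects anticommutators; the
  Clifford relations of the units are special cases.\<close>

lemma act_swap: "act p (act q x) + act q (act p x) = act (p * q) x + act (q * p) x"
  using module_associator_swap[of p q x] by (simp add: module_associator_def algebra_simps)

abbreviation L :: "nat \<Rightarrow> 'a \<Rightarrow> 'a" where
  "L k \<equiv> act (imag_unit k)"

lemma L_L:
  assumes "1 \<le> k" "k \<le> 7"
  shows "L k (L k x) = - x"
proof -
  have "2 *\<^sub>R L k (L k x) = 2 *\<^sub>R (- x)"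
    using act_swap[of "imag_unit k" "imag_unit k" x]
    by (simp add: imag_unit_square[OF assms] act_simps scaleR_2)
  then show ?thesis by (simp del: scaleR_minus_right)
qed

lemma L_anticommute:
  assumes "i < j"
  shows "L j (L i x) = - L i (L j x)"
  using act_swap[of "imag_unit i" "imag_unit j" x] assms
  by (simp add: imag_unit_anticommute[of i j] act_simps eq_neg_iff_add_eq_0 add.commute)

text \<open>As rewrite rules these sort a word in the units by increasing index and cancel squares,
  so signed identities between words reduce to normal forms.\<close>

lemmas L_simps = L_L L_anticommute act_simps

lemma act_expand:
  "act p x = oc0 p *\<^sub>R x + oc1 p *\<^sub>R L 1 x + oc2 p *\<^sub>R L 2 x + oc3 p *\<^sub>R L 3 x
    + oc4 p *\<^sub>R L 4 x + oc5 p *\<^sub>R L 5 x + oc6 p *\<^sub>R L 6 x + oc7 p *\<^sub>R L 7 x"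
  by (subst octonion_decomp[of p]) (simp add: act_simps)

text \<open>Applying one of the three units to the hypothesis cancels it from the word. In this
  labelling every Fano line \<open>i < j < k\<close> satisfies e_i e_j = e_k, so the conclusions are
  the octonion products on that line.\<close>

lemma L_pairs:
  assumes "1 \<le> i" "i < j" "j < k" "k \<le> 7" and "L i (L j (L k y)) = - y"
  shows "L j (L k y) = L i y" "L i (L k y) = - L j y" "L i (L j y) = L k y"
proof -
  have eqs: "L i (L i (L j (L k y))) = L i (- y)" "L j (L i (L j (L k y))) = L j (- y)"
    "L k (L i (L j (L k y))) = L k (- y)"
    using assms(5) by simp_all
  show "L j (L k y) = L i y"
    using eqs(1) assms(1-4) by (simp add: L_simps)
  show "L i (L k y) = - L j y"
    using eqs(2) assms(1-4) by (simp add: L_simps)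
  show "L i (L j y) = L k y"
    using eqs(3) assms(1-4) by (simp add: L_simps)
qed

lemma associative_elementI:
  assumes "L 1 (L 2 (L 4 y)) = - y" "L 2 (L 3 (L 5 y)) = - y" "L 3 (L 4 (L 6 y)) = - y"
    and "L 1 (L 2 (L 3 (L 4 (L 5 (L 6 (L 7 y)))))) = - y"
  shows "y \<in> associative_elements act"
proof -
  let ?A = "\<lambda>z. L 1 (L 2 (L 4 z))" and ?B = "\<lambda>z. L 2 (L 3 (L 5 z))" and ?C = "\<lambda>z. L 3 (L 4 (L 6 z))"
    and ?w = "\<lambda>z. L 1 (L 2 (L 3 (L 4 (L 5 (L 6 (L 7 z))))))"
  \<comment> \<open>These products of the given words are, after cancellation, the words of the four
    remaining Fano lines (1,5,6), (2,6,7), (1,3,7), (4,5,7), in this order; \<open>?w\<close> turns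
    a word in four units into one in the complementary three. Once all seven lines are known, the
    units multiply on \<open>y\<close> as in the octonions.\<close>
  have "?A (?B (?C y)) = - y" "?w (?A (?B y)) = - y" "?w (?B (?C y)) = - y" "?w (?A (?C y)) = - y"
    using assms by (simp_all only: act_simps minus_minus)
  then have t: "L 1 (L 5 (L 6 y)) = - y" "L 2 (L 6 (L 7 y)) = - y" "L 1 (L 3 (L 7 y)) = - y"
      "L 4 (L 5 (L 7 y)) = - y"
    by (simp_all add: L_simps)
  note pairs = L_pairs[OF _ _ _ _ t(1), simplified] L_pairs[OF _ _ _ _ t(2), simplified]
    L_pairs[OF _ _ _ _ t(3), simplified] L_pairs[OF _ _ _ _ t(4), simplified]
    L_pairs[OF _ _ _ _ assms(1), simplified] L_pairs[OF _ _ _ _ assms(2), simplified]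
    L_pairs[OF _ _ _ _ assms(3), simplified]
  have units: "act (imag_unit i * imag_unit j) y = L i (L j y)" if "i \<in> {1..7}" "j \<in> {1..7}" for i j
  proof -
    have ij: "i \<in> {1, 2, 3, 4, 5, 6, 7}" "j \<in> {1, 2, 3, 4, 5, 6, 7}" using that by auto
    then show ?thesis
      by (elim insertE emptyE; hypsubst)
        (simp_all add: L_simps pairs imag_unit_square imag_unit_anticommute imag_unit_times[simplified])
  qed
  have "act (p * q) y = act p (act q y)" for p q
  proof (rule linear_octonion_eqI[of "\<lambda>q. act (p * q) y" "\<lambda>q. act p (act q y)"])
    show "linear (\<lambda>q. act (p * q) y)" "linear (\<lambda>q. act p (act q y))"
      by (auto intro!: linearI simp: act_simps bilinear_radd[OF bilinear_times_octonion]
        bilinear_rmul[OF bilinear_times_octonion])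
    show "act (p * 1) y = act p (act 1 y)" by (simp add: octonion_one_times act_one)
    show "act (p * imag_unit k) y = act p (L k y)" if k: "k \<in> {1..7}" for k
    proof (rule linear_octonion_eqI[of "\<lambda>p. act (p * imag_unit k) y" "\<lambda>p. act p (L k y)"])
      show "linear (\<lambda>p. act (p * imag_unit k) y)" "linear (\<lambda>p. act p (L k y))"
        by (auto intro!: linearI simp: act_simps bilinear_ladd[OF bilinear_times_octonion]
          bilinear_lmul[OF bilinear_times_octonion])
    qed (use units k in \<open>simp_all add: octonion_one_times act_one\<close>)
  qed
  then show ?thesis by (simp add: associative_elements_def)
qed

section \<open>Associative and conjugate associative vectors in submodules\<close>

lemma nonzero_associative_element_minus:
  assumes W: "subspace W" "\<And>p z. z \<in> W \<Longrightarrow> act p z \<in> W"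
    and y: "y \<in> W" "y \<noteq> 0" "L 1 (L 2 (L 3 (L 4 (L 5 (L 6 (L 7 y)))))) = - y"
  shows "\<exists>z\<in>W. z \<noteq> 0 \<and> z \<in> associative_elements act"
proof -
  define w a b c where "w = (\<lambda>z. L 1 (L 2 (L 3 (L 4 (L 5 (L 6 (L 7 z)))))))"
    and "a = (\<lambda>z. L 1 (L 2 (L 4 z)))" and "b = (\<lambda>z. L 2 (L 3 (L 5 z)))"
    and "c = (\<lambda>z. L 3 (L 4 (L 6 z)))"
  note ops = w_def a_def b_def c_def
  have lin: "linear w" "linear a" "linear b" "linear c"
    by (auto simp: ops act_simps intro!: linearI)
  have inv: "a (a z) = z" "b (b z) = z" "c (c z) = z" for z
    by (simp_all add: ops L_simps)
  \<comment> \<open>Each unit anticommutes with the six others and so commutes with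
    \<open>w\<close>. Two Fano lines share one unit, so exchanging their words costs eight
    signs.\<close>
  have comm: "w (a z) = a (w z)" "w (b z) = b (w z)" "w (c z) = c (w z)"
      "a (b z) = b (a z)" "a (c z) = c (a z)" "b (c z) = c (b z)" for z
    by (simp_all add: ops L_simps)
  \<comment> \<open>A unit commutes with the word of a Fano line through it and anticommutes with
    the word of any other line. So unit 3 corrects \<open>a\<close>; unit 1 lies on the line of
    \<open>a\<close> but not of \<open>b\<close>; unit 2 lies on those of \<open>a\<close> and
    \<open>b\<close> but not of \<open>c\<close>.\<close>
  have flip: "w (L 3 z) = L 3 (w z)" "w (L 1 z) = L 1 (w z)" "w (L 2 z) = L 2 (w z)"
      "a (L 3 z) = - L 3 (a z)" "a (L 1 z) = L 1 (a z)" "a (L 2 z) = L 2 (a z)"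
      "b (L 1 z) = - L 1 (b z)" "b (L 2 z) = L 2 (b z)" "c (L 2 z) = - L 2 (c z)" for z
    by (simp_all add: ops L_simps)
  have neg: "w (- z) = - w z" "a (- z) = - a z" "b (- z) = - b z" "c (- z) = - c z" for z
    by (simp_all add: ops act_simps)
  have nz: "z = 0" if "L k z = 0" "k \<in> {1..7}" for k z
    using L_L[of k z] that by (simp add: act_simps)
  have W': "a z \<in> W" "b z \<in> W" "c z \<in> W" if "z \<in> W" for z
    using that by (simp_all add: ops W(2))
  have eigensub: "subspace {z \<in> V. f z = - z}" if "subspace V" "linear f" for V and f :: "'a \<Rightarrow> 'a"
    using that by (auto simp: subspace_def linear_0 linear_add linear_scale)
  define W1 where "W1 = {z \<in> W. w z = - z}"
  define W2 where "W2 = {z \<in> W1. a z = - z}"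
  define W3 where "W3 = {z \<in> W2. b z = - z}"
  have sub: "subspace W1" "subspace W2" "subspace W3"
    unfolding W1_def W2_def W3_def by (intro eigensub W lin)+
  have "y \<in> W1" using y by (simp add: W1_def w_def)
  have "\<exists>z\<in>W1. z \<noteq> 0 \<and> a z = - z"
  proof (rule involution_eigenvector)
    show "a z \<in> W1" "L 3 z \<in> W1" if "z \<in> W1" for z
      using that by (simp_all add: W1_def W(2) W' comm flip[simplified] neg act_simps)
    show "z = 0" if "L 3 z = 0" for z using nz[OF that] by simp
    show "a (a z) = z" "a (L 3 z) = - L 3 (a z)" for z
      by (fact inv flip)+
    show "y \<in> W1" "y \<noteq> 0"
      by fact+
  qed (fact sub lin linear_act)+
  then obtain y1 where "y1 \<in> W1" "y1 \<noteq> 0" "a y1 = - y1"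
    by blast
  then have "y1 \<in> W2" by (simp add: W2_def)
  have "\<exists>z\<in>W2. z \<noteq> 0 \<and> b z = - z"
  proof (rule involution_eigenvector)
    show "b z \<in> W2" "L 1 z \<in> W2" if "z \<in> W2" for z
      using that by (simp_all add: W1_def W2_def W(2) W' comm flip[simplified] neg act_simps)
    show "z = 0" if "L 1 z = 0" for z using nz[OF that] by simp
    show "b (b z) = z" "b (L 1 z) = - L 1 (b z)" for z
      by (fact inv flip)+
    show "y1 \<in> W2" "y1 \<noteq> 0"
      by fact+
  qed (fact sub lin linear_act)+
  then obtain y2 where "y2 \<in> W2" "y2 \<noteq> 0" "b y2 = - y2"
    by blast
  then have "y2 \<in> W3" by (simp add: W3_def)
  have "\<exists>z\<in>W3. z \<noteq> 0 \<and> c z = - z"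
  proof (rule involution_eigenvector)
    show "c z \<in> W3" "L 2 z \<in> W3" if "z \<in> W3" for z
      using that by (simp_all add: W1_def W2_def W3_def W(2) W' comm flip[simplified] neg act_simps)
    show "z = 0" if "L 2 z = 0" for z using nz[OF that] by simp
    show "c (c z) = z" "c (L 2 z) = - L 2 (c z)" for z
      by (fact inv flip)+
    show "y2 \<in> W3" "y2 \<noteq> 0"
      by fact+
  qed (fact sub lin linear_act)+
  then obtain y3 where "y3 \<in> W3" "y3 \<noteq> 0" "c y3 = - y3"
    by blast
  then show ?thesis
    by (intro bexI[of _ y3]) (auto simp: W1_def W2_def W3_def ops intro: associative_elementI)
qed

text \<open>Conjugation reverses products, but \<open>act_swap\<close> is symmetric in the two
  orders and so survives the twist.\<close>

lemma left_octonion_module_cnj: "left_octonion_module (\<lambda>p. act (oct_cnj p))"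
proof
  show "bilinear (\<lambda>p. act (oct_cnj p))"
    unfolding bilinear_def
    by (auto intro!: linearI simp: linear_add[OF linear_oct_cnj] linear_scale[OF linear_oct_cnj] act_simps)
  show "act (oct_cnj 1) x = x" for x
    by (simp add: oct_cnj_one act_one)
  show "module_associator (\<lambda>p. act (oct_cnj p)) p q x = - module_associator (\<lambda>p. act (oct_cnj p)) q p x"
    for p q x
    using act_swap[of "oct_cnj p" "oct_cnj q" x]
    by (simp add: module_associator_def oct_cnj_times algebra_simps)
qed

lemma associative_elements_cnj:
  "associative_elements (\<lambda>p. act (oct_cnj p)) = conjugate_associative_elements act"
  unfolding associative_elements_def conjugate_associative_elements_def
  by (auto simp: oct_cnj_times) (metis oct_cnj_cnj)

lemma nonzero_associative_element:
  assumes W: "subspace W" "\<And>p z. z \<in> W \<Longrightarrow> act p z \<in> W" and "W \<noteq> {0}"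
  shows "\<exists>z\<in>W. z \<noteq> 0 \<and> z \<in> associative_elements act \<union> conjugate_associative_elements act"
proof -
  obtain y where y: "y \<in> W" "y \<noteq> 0"
    using assms subspace_0 by blast
  define w where "w = (\<lambda>z. L 1 (L 2 (L 3 (L 4 (L 5 (L 6 (L 7 z)))))))"
  have ww: "w (w z) = z" for z
    by (simp add: w_def L_simps)
  have lin: "linear w"
    by (auto simp: w_def act_simps intro!: linearI)
  show ?thesis
  proof (cases "w y = y")
    case True
    interpret cnj: left_octonion_module "\<lambda>p. act (oct_cnj p)"
      by (rule left_octonion_module_cnj)
    \<comment> \<open>Seven conjugated units contribute an odd number of signs, turning eigenvalue 1
      of \<open>w\<close> into -1.\<close>
    have "cnj.L 1 (cnj.L 2 (cnj.L 3 (cnj.L 4 (cnj.L 5 (cnj.L 6 (cnj.L 7 y)))))) = - w y"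
      by (simp add: oct_cnj_imag_unit act_simps w_def)
    then show ?thesis
      using cnj.nonzero_associative_element_minus[OF W(1) _ y] W(2) True
      by (auto simp: associative_elements_cnj)
  next
    case False
    have "y - w y \<in> W" using W y by (simp add: subspace_diff w_def)
    moreover have "w (y - w y) = - (y - w y)" by (simp add: linear_diff[OF lin] ww)
    ultimately show ?thesis
      using nonzero_associative_element_minus[OF W, of "y - w y"] False by (auto simp: w_def)
  qed
qed

section \<open>Real bilinear forms on associative and conjugate associative vectors\<close>

lemma subspace_associative_elements: "subspace (associative_elements act)"
  by (auto simp: subspace_def associative_elements_def act_simps)

lemma subspace_conjugate_associative_elements: "subspace (conjugate_associative_elements act)"
  by (auto simp: subspace_def conjugate_associative_elements_def act_simps)

text \<open>Moving the action across \<open>B\<close> in two ways shows that \<open>p \<mapsto> B (p u) v\<close> kills all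
  associators of octonions, and these span the imaginary octonions.\<close>

lemma adjoint_form_associative:
  fixes B :: "'a \<Rightarrow> 'a \<Rightarrow> real"
  assumes "bilinear B" and adj: "\<And>p u v. B (act p u) v = B u (act (oct_cnj p) v)"
    and u: "u \<in> associative_elements act" and v: "v \<in> associative_elements act"
  shows "B (act p u) v = oct_Re p * B u v"
proof -
  have act_u: "act p (act q u) = act (p * q) u" and act_v: "act p (act q v) = act (p * q) v" for p q
    using u v by (simp_all add: associative_elements_def)
  have killed: "B (act ((p * q) * r) u) v = B (act (p * (q * r)) u) v" for p q r
  proof -
    have "B (act ((p * q) * r) u) v = B (act r u) (act (oct_cnj (p * q)) v)"
      by (simp flip: act_u add: adj)
    also have "\<dots> = B (act p (act q (act r u))) v"
      by (simp add: adj act_v oct_cnj_times)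
    finally show ?thesis by (simp add: act_u)
  qed
  note B = bilinear_ladd[OF \<open>bilinear B\<close>] bilinear_lneg[OF \<open>bilinear B\<close>] bilinear_lmul[OF \<open>bilinear B\<close>]
  note units = imag_unit_times[simplified] imag_unit_anticommute
    bilinear_lneg[OF bilinear_times_octonion] bilinear_rneg[OF bilinear_times_octonion]
  \<comment> \<open>With indices modulo 7, the units k+2, k+3, k+4 multiply to -e_k or e_k depending
    on the bracketing, so \<open>killed\<close> equates each value with its negative.\<close>
  have "B (L 1 u) v = 0" "B (L 2 u) v = 0" "B (L 3 u) v = 0" "B (L 4 u) v = 0" "B (L 5 u) v = 0"
    "B (L 6 u) v = 0" "B (L 7 u) v = 0"
    using killed[of "imag_unit 3" "imag_unit 4" "imag_unit 5"]
      killed[of "imag_unit 4" "imag_unit 5" "imag_unit 6"]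
      killed[of "imag_unit 5" "imag_unit 6" "imag_unit 7"]
      killed[of "imag_unit 6" "imag_unit 7" "imag_unit 1"]
      killed[of "imag_unit 7" "imag_unit 1" "imag_unit 2"]
      killed[of "imag_unit 1" "imag_unit 2" "imag_unit 3"]
      killed[of "imag_unit 2" "imag_unit 3" "imag_unit 4"]
    by (simp_all add: units act_simps B)
  then show ?thesis
    by (simp add: act_expand[of p] B oct_Re_def)
qed

text \<open>Products recombine in the opposite order on \<open>v\<close>. Hence the form vanishes on
  commutators, which yield all the units; the value at 1 needs the reversal of a triple
  product.\<close>

lemma adjoint_form_mixed:
  fixes B :: "'a \<Rightarrow> 'a \<Rightarrow> real"
  assumes "bilinear B" and adj: "\<And>p u v. B (act p u) v = B u (act (oct_cnj p) v)"
    and u: "u \<in> associative_elements act" and v: "v \<in> conjugate_associative_elements act"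
  shows "B (act p u) v = 0"
proof -
  have act_u: "act p (act q u) = act (p * q) u" and act_v: "act p (act q v) = act (q * p) v" for p q
    using u v by (simp_all add: associative_elements_def conjugate_associative_elements_def)
  have comm: "B (act (p * q) u) v = B (act (q * p) u) v" for p q
  proof -
    have "B (act (p * q) u) v = B u (act (oct_cnj (q * p)) v)"
      by (simp flip: act_u add: adj act_v oct_cnj_times)
    then show ?thesis by (simp add: adj)
  qed
  have rev: "B (act (p * (q * r)) u) v = B (act (r * (q * p)) u) v" for p q r
  proof -
    have "B (act (p * (q * r)) u) v = B u (act (oct_cnj (r * (q * p))) v)"
      by (simp flip: act_u add: adj act_v oct_cnj_times)
    then show ?thesis by (simp add: adj)
  qed
  note B = bilinear_ladd[OF \<open>bilinear B\<close>] bilinear_lneg[OF \<open>bilinear B\<close>] bilinear_lmul[OF \<open>bilinear B\<close>]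
  note units = imag_unit_times[simplified] imag_unit_anticommute imag_unit_square
    bilinear_lneg[OF bilinear_times_octonion] bilinear_rneg[OF bilinear_times_octonion]
  have "B (L 1 u) v = 0" "B (L 2 u) v = 0" "B (L 3 u) v = 0" "B (L 4 u) v = 0" "B (L 5 u) v = 0"
    "B (L 6 u) v = 0" "B (L 7 u) v = 0"
    using comm[of "imag_unit 2" "imag_unit 4"] comm[of "imag_unit 3" "imag_unit 5"]
      comm[of "imag_unit 4" "imag_unit 6"] comm[of "imag_unit 5" "imag_unit 7"]
      comm[of "imag_unit 1" "imag_unit 6"] comm[of "imag_unit 2" "imag_unit 7"]
      comm[of "imag_unit 1" "imag_unit 3"]
    by (simp_all add: units act_simps B)
  \<comment> \<open>Here e1 (e2 e4) = -1, while the reversed product e4 (e2 e1) is 1.\<close>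
  moreover have "B u v = 0"
    using rev[of "imag_unit 1" "imag_unit 2" "imag_unit 4"] by (simp add: units act_simps B)
  ultimately show ?thesis
    by (simp add: act_expand[of p] B)
qed

end

section \<open>Orthonormal bases from Zorn's lemma\<close>

lemma orthonormal_basis_exists: "\<exists>S. orthonormal_basis V ip S (\<lambda>u. u)"
proof -
  have "\<exists>M\<in>{S. orthonormal_system V ip S (\<lambda>u. u)}. \<forall>X\<in>{S. orthonormal_system V ip S (\<lambda>u. u)}. M \<subseteq> X \<longrightarrow> X = M"
  proof (rule subset_Zorn')
    fix \<C> assume "subset.chain {S. orthonormal_system V ip S (\<lambda>u. u)} \<C>"
    then have sys: "\<And>S. S \<in> \<C> \<Longrightarrow> orthonormal_system V ip S (\<lambda>u. u)"
      and chain: "\<And>S T. S \<in> \<C> \<Longrightarrow> T \<in> \<C> \<Longrightarrow> S \<subseteq> T \<or> T \<subseteq> S"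
      by (auto simp: subset_chain_def)
    \<comment> \<open>Of two members of the chain the larger contains both vectors.\<close>
    have "ip u v = (if u = v then 1 else 0)" if "S \<in> \<C>" "T \<in> \<C>" "u \<in> S" "v \<in> T" for S T u v
      using sys[OF that(1)] sys[OF that(2)] chain[OF that(1,2)] that(3,4)
      unfolding orthonormal_system_def by blast
    moreover have "\<Union>\<C> \<subseteq> V"
      using sys unfolding orthonormal_system_def by blast
    ultimately show "\<Union>\<C> \<in> {S. orthonormal_system V ip S (\<lambda>u. u)}"
      unfolding orthonormal_system_def by auto
  qed
  then show ?thesis
    unfolding orthonormal_basis_def by auto
qed

section \<open>The octonionic inner product on the two real subspaces\<close>

context hilbert_octonion_module
begin

lemmas ip_simps =
  bilinear_ladd[OF bilinear_ip] bilinear_radd[OF bilinear_ip]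
  bilinear_lmul[OF bilinear_ip] bilinear_rmul[OF bilinear_ip]
  bilinear_lzero[OF bilinear_ip] bilinear_rzero[OF bilinear_ip]

lemmas Re_simps = linear_add[OF linear_oct_Re] linear_diff[OF linear_oct_Re] linear_scale[OF linear_oct_Re]

lemma Re_ip_act: "oct_Re (ip (act p u) v) = oct_Re (p * ip u v)"
  using Re_second_associator[of p u v] by (simp add: second_associator_def Re_simps)

lemma Re_ip_commute: "oct_Re (ip u v) = oct_Re (ip v u)"
  by (subst ip_cnj) simp

lemma Re_ip_adjoint: "oct_Re (ip (act p u) v) = oct_Re (ip u (act (oct_cnj p) v))"
proof -
  have "oct_Re (ip u (act (oct_cnj p) v)) = oct_Re (oct_cnj p * oct_cnj (ip u v))"
    by (simp add: Re_ip_commute[of u] Re_ip_act ip_cnj[of v u])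
  also have "\<dots> = oct_Re (p * ip u v)"
    by (simp add: octonion_defs)
  finally show ?thesis by (simp add: Re_ip_act)
qed

lemma bilinear_Re_ip: "bilinear (\<lambda>u v. oct_Re (ip u v))"
  unfolding bilinear_def by (auto intro!: linearI simp: ip_simps Re_simps)

lemma ip_eq_0_if_associative_conjugate:
  assumes "u \<in> associative_elements act" "v \<in> conjugate_associative_elements act"
  shows "ip u v = 0" "ip v u = 0"
proof -
  show "ip u v = 0"
  proof (rule octonion_eq_if_Re_times_eq)
    show "oct_Re (p * ip u v) = oct_Re (p * 0)" for p
      using adjoint_form_mixed[OF bilinear_Re_ip Re_ip_adjoint assms, of p]
      by (simp add: Re_ip_act bilinear_rzero[OF bilinear_times_octonion] linear_0[OF linear_oct_Re])
  qed
  then show "ip v u = 0"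
    using ip_cnj[of v u] by (simp add: linear_0[OF linear_oct_cnj])
qed

text \<open>Both sides have the same real part after multiplication by any \<open>p\<close>. The
  conjugate associative case is the associative one for the conjugated action, as \<open>p\<close>
  and its conjugate have equal real parts.\<close>

lemma ip_real:
  assumes "u \<in> associative_elements act \<and> v \<in> associative_elements act \<or>
    u \<in> conjugate_associative_elements act \<and> v \<in> conjugate_associative_elements act"
  shows "ip u v = oct_Re (ip u v) *\<^sub>R 1"
proof (rule octonion_eq_if_Re_times_eq)
  fix p
  have "oct_Re (ip (act p u) v) = oct_Re p * oct_Re (ip u v)"
    using assms
  proof
    assume "u \<in> associative_elements act \<and> v \<in> associative_elements act"
    then show ?thesis
      using adjoint_form_associative[OF bilinear_Re_ip Re_ip_adjoint] by blast
  next
    interpret cnj: left_octonion_module "\<lambda>p. act (oct_cnj p)"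
      by (rule left_octonion_module_cnj)
    have adj: "oct_Re (ip (act (oct_cnj p) u) v) = oct_Re (ip u (act (oct_cnj (oct_cnj p)) v))" for p u v
      by (rule Re_ip_adjoint)
    assume "u \<in> conjugate_associative_elements act \<and> v \<in> conjugate_associative_elements act"
    then show ?thesis
      using cnj.adjoint_form_associative[OF bilinear_Re_ip adj, of u v "oct_cnj p"]
      by (simp add: associative_elements_cnj)
  qed
  then show "oct_Re (p * ip u v) = oct_Re (p * (oct_Re (ip u v) *\<^sub>R 1))"
    by (simp add: Re_ip_act bilinear_rmul[OF bilinear_times_octonion] octonion_one_times Re_simps)
qed

text \<open>Acting on \<open>u\<close> by \<open>p\<close> and then \<open>q\<close> is acting by
  \<open>q * p\<close> or \<open>p * q\<close>. Their real parts agree, and against a real inner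
  product only the real part counts.\<close>

lemma second_associator_eq_0:
  assumes u: "u \<in> associative_elements act \<union> conjugate_associative_elements act"
    and r: "ip u v = r *\<^sub>R 1"
  shows "second_associator act ip p u v = 0"
proof -
  have "ip (act p u) v = p * ip u v"
  proof (rule octonion_eq_if_Re_times_eq)
    fix q
    have "oct_Re (q * ip (act p u) v) = oct_Re (ip (act q (act p u)) v)"
      by (simp add: Re_ip_act)
    also have "\<dots> = r * oct_Re (q * p)"
    proof -
      obtain s where s: "act q (act p u) = act s u" "s = q * p \<or> s = p * q"
        using u unfolding associative_elements_def conjugate_associative_elements_def Un_iff mem_Collect_eq
        by metis
      have "oct_Re s = oct_Re (q * p)"
        using s(2) by (auto simp: octonion_defs)
      then show ?thesis
        by (simp add: s(1) r Re_ip_act[of s] bilinear_rmul[OF bilinear_times_octonion]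
          octonion_one_times Re_simps)
    qed
    finally show "oct_Re (q * ip (act p u) v) = oct_Re (q * (p * ip u v))"
      by (simp add: r bilinear_rmul[OF bilinear_times_octonion] octonion_one_times Re_simps)
  qed
  then show ?thesis by (simp add: second_associator_def)
qed

text \<open>Otherwise the normalised vector would enlarge the system and contradict
  maximality.\<close>

lemma orthogonal_to_orthonormal_basis:
  assumes basis: "orthonormal_basis V (\<lambda>u v. oct_Re (ip u v)) I x"
    and V: "subspace V" "z \<in> V" and orth: "\<And>i. i \<in> I \<Longrightarrow> oct_Re (ip z (x i)) = 0"
  shows "z = 0"
proof (rule ccontr)
  assume "z \<noteq> 0"
  obtain r where r: "r \<ge> 0" "ip z z = r *\<^sub>R 1"
    using ip_self_nonneg by blast
  then have "r > 0"
    using ip_self_eq_0_iff[of z] \<open>z \<noteq> 0\<close> by (cases "r = 0") auto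
  define z' where "z' = (1 / sqrt r) *\<^sub>R z"
  have "ip z' z' = (r / (sqrt r * sqrt r)) *\<^sub>R 1"
    by (simp add: z'_def ip_simps r(2))
  then have z': "z' \<in> V" "oct_Re (ip z' z') = 1"
    using V \<open>r > 0\<close> by (simp_all add: z'_def subspace_scale oct_Re_def one_octonion_def)
  have orth': "oct_Re (ip z' (x i)) = 0" "oct_Re (ip (x i) z') = 0" if "i \<in> I" for i
    using orth[OF that] Re_ip_commute[of z "x i"] by (simp_all add: z'_def ip_simps Re_simps)
  have x: "x ` I \<subseteq> V"
    using basis unfolding orthonormal_basis_def orthonormal_system_def by blast
  \<comment> \<open>Maximality concerns sets, so the delta on indices is restated for vectors;
    distinct indices have distinct vectors because 0 and 1 differ.\<close>
  have Re_ip_x: "oct_Re (ip (x i) (x j)) = (if x i = x j then 1 else 0)" if "i \<in> I" "j \<in> I" for i j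
    using basis that unfolding orthonormal_basis_def orthonormal_system_def
    by (cases "i = j") (simp, metis zero_neq_one)
  have notin: "z' \<noteq> x i" if "i \<in> I" for i
    using orth'[OF that] z'(2) by auto
  have "oct_Re (ip u v) = (if u = v then 1 else 0)"
    if "u \<in> insert z' (x ` I)" "v \<in> insert z' (x ` I)" for u v
    using that by (elim insertE imageE) (simp_all add: z'(2) orth' Re_ip_x notin notin[symmetric])
  then have "orthonormal_system V (\<lambda>u v. oct_Re (ip u v)) (insert z' (x ` I)) (\<lambda>u. u)"
    using x z'(1) unfolding orthonormal_system_def by blast
  moreover have "x ` I \<subset> insert z' (x ` I)"
    using notin by blast
  ultimately show False
    using basis unfolding orthonormal_basis_def by blast
qed

section \<open>The union of the two real bases\<close>

lemma weak_associative_orthonormal_basis_Un: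
  assumes disj: "I \<inter> J = {}"
    and I: "orthonormal_basis (associative_elements act) (\<lambda>u v. oct_Re (ip u v)) I x"
    and J: "orthonormal_basis (conjugate_associative_elements act) (\<lambda>u v. oct_Re (ip u v)) J x"
  shows "weak_associative_orthonormal_basis act ip (I \<union> J) x"
proof -
  have sysI: "orthonormal_system (associative_elements act) (\<lambda>u v. oct_Re (ip u v)) I x"
    and sysJ: "orthonormal_system (conjugate_associative_elements act) (\<lambda>u v. oct_Re (ip u v)) J x"
    using I J by (simp_all add: orthonormal_basis_def)
  have xI: "x i \<in> associative_elements act" if "i \<in> I" for i
    using sysI that unfolding orthonormal_system_def by blast
  have xJ: "x j \<in> conjugate_associative_elements act" if "j \<in> J" for j
    using sysJ that unfolding orthonormal_system_def by blast
  have Re_ip_x: "oct_Re (ip (x i) (x j)) = (if i = j then 1 else 0)"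
    if "i \<in> I \<and> j \<in> I \<or> i \<in> J \<and> j \<in> J" for i j
    using sysI sysJ that unfolding orthonormal_system_def by blast
  have ip_x: "ip (x i) (x j) = (if i = j then 1 else 0)" if "i \<in> I \<union> J" "j \<in> I \<union> J" for i j
  proof (cases "i \<in> I \<and> j \<in> I \<or> i \<in> J \<and> j \<in> J")
    case True
    then show ?thesis
      using ip_real[of "x i" "x j"] Re_ip_x[OF True] xI xJ by (metis scaleR_one scaleR_zero_left)
  next
    case False
    then show ?thesis
      using that disj xI xJ ip_eq_0_if_associative_conjugate by auto
  qed
  define W where "W = {w. \<forall>i\<in>I \<union> J. ip w (x i) = 0}"
  have "subspace W"
    by (auto simp: W_def subspace_def ip_simps)
  moreover have "act p w \<in> W" if "w \<in> W" for p w
    unfolding W_def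
  proof (intro CollectI ballI octonion_eq_if_Re_times_eq)
    fix i q assume i: "i \<in> I \<union> J"
    \<comment> \<open>On a basis vector two successive actions combine into one; writing it with a
      conjugate lets it move back to \<open>w\<close>.\<close>
    obtain r where r: "act (oct_cnj p) (act (oct_cnj q) (x i)) = act (oct_cnj r) (x i)"
      using i xI[of i] xJ[of i]
      unfolding associative_elements_def conjugate_associative_elements_def Un_iff mem_Collect_eq
      by (metis oct_cnj_cnj)
    have "oct_Re (q * ip (act p w) (x i)) = oct_Re (ip (act q (act p w)) (x i))"
      by (rule Re_ip_act[symmetric])
    also have "\<dots> = oct_Re (ip w (act (oct_cnj r) (x i)))"
      by (simp only: Re_ip_adjoint r)
    also have "\<dots> = oct_Re (r * ip w (x i))"
      by (simp only: Re_ip_adjoint[symmetric] Re_ip_act)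
    finally have "oct_Re (q * ip (act p w) (x i)) = oct_Re (r * ip w (x i))" .
    then show "oct_Re (q * ip (act p w) (x i)) = oct_Re (q * 0)"
      using that i by (simp add: W_def bilinear_rzero[OF bilinear_times_octonion])
  qed
  moreover have "w = 0" if "w \<in> W" "w \<in> associative_elements act \<union> conjugate_associative_elements act" for w
    using that orthogonal_to_orthonormal_basis[OF I subspace_associative_elements]
      orthogonal_to_orthonormal_basis[OF J subspace_conjugate_associative_elements]
    by (auto simp: W_def linear_0[OF linear_oct_Re])
  ultimately have W: "W = {0}"
    using nonzero_associative_element[of W] by blast
  have "\<not> orthonormal_system UNIV ip T (\<lambda>u. u)" if "x ` (I \<union> J) \<subset> T" for T
  proof
    assume T: "orthonormal_system UNIV ip T (\<lambda>u. u)"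
    obtain y where "y \<in> T" "y \<notin> x ` (I \<union> J)"
      using \<open>x ` (I \<union> J) \<subset> T\<close> by blast
    have "ip y (x i) = 0" if "i \<in> I \<union> J" for i
      using T \<open>x ` (I \<union> J) \<subset> T\<close> \<open>y \<in> T\<close> \<open>y \<notin> x ` (I \<union> J)\<close> that
      unfolding orthonormal_system_def by (metis imageI psubsetD)
    moreover have "ip y y = 1"
      using T \<open>y \<in> T\<close> unfolding orthonormal_system_def by simp
    ultimately have "y \<in> W" "ip y y = 1"
      by (simp_all add: W_def)
    then show False
      using W by (simp add: ip_simps)
  qed
  moreover have "orthonormal_system UNIV ip (I \<union> J) x"
    using ip_x unfolding orthonormal_system_def by blast
  ultimately have "orthonormal_basis UNIV ip (I \<union> J) x"
    unfolding orthonormal_basis_def by blast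
  moreover have "second_associator act ip p (x i) (x j) = 0" if "i \<in> I \<union> J" "j \<in> I \<union> J" for p i j
  proof (rule second_associator_eq_0)
    show "x i \<in> associative_elements act \<union> conjugate_associative_elements act"
      using that xI xJ by blast
    show "ip (x i) (x j) = (if i = j then 1 else 0) *\<^sub>R 1"
      using that by (simp add: ip_x)
  qed
  ultimately show ?thesis
    unfolding weak_associative_orthonormal_basis_def by blast
qed

lemma weak_associative_orthonormal_basis_exists:
  "\<exists>S. weak_associative_orthonormal_basis act ip S (\<lambda>u. u)"
proof -
  obtain S where S: "orthonormal_basis (associative_elements act) (\<lambda>u v. oct_Re (ip u v)) S (\<lambda>u. u)"
    using orthonormal_basis_exists by blast
  obtain S' where S': "orthonormal_basis (conjugate_associative_elements act) (\<lambda>u v. oct_Re (ip u v)) S' (\<lambda>u. u)"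
    using orthonormal_basis_exists by blast
  \<comment> \<open>A common vector would be both associative and conjugate associative, hence
    orthogonal to itself.\<close>
  have "S \<inter> S' = {}"
  proof (rule ccontr)
    assume "S \<inter> S' \<noteq> {}"
    then obtain u where "u \<in> S" "u \<in> S'" by blast
    then have "u \<in> associative_elements act" "u \<in> conjugate_associative_elements act" "oct_Re (ip u u) = 1"
      using S S' unfolding orthonormal_basis_def orthonormal_system_def by auto
    then show False
      using ip_eq_0_if_associative_conjugate[of u u] by (simp add: linear_0[OF linear_oct_Re])
  qed
  then show ?thesis
    using weak_associative_orthonormal_basis_Un[OF _ S S'] by blast
qed

end

theorem mainTheorem4:
  fixes act :: "octonion \<Rightarrow> 'a::real_vector \<Rightarrow> 'a"
    and ip :: "'a \<Rightarrow> 'a \<Rightarrow> octonion"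
  assumes "hilbert_octonion_module act ip"
  shows "(\<exists>S :: 'a set. weak_associative_orthonormal_basis act ip S (\<lambda>u. u)) \<and>
    (\<forall>(\<Lambda> :: 'i set) \<Lambda>' (x :: 'i \<Rightarrow> 'a).
      \<Lambda> \<inter> \<Lambda>' = {} \<longrightarrow>
      orthonormal_basis (associative_elements act) (\<lambda>u v. oct_Re (ip u v)) \<Lambda> x \<longrightarrow>
      orthonormal_basis (conjugate_associative_elements act) (\<lambda>u v. oct_Re (ip u v)) \<Lambda>' x \<longrightarrow>
      weak_associative_orthonormal_basis act ip (\<Lambda> \<union> \<Lambda>') x)"
proof -
  interpret hilbert_octonion_module act ip by fact
  show ?thesis
    using weak_associative_orthonormal_basis_exists weak_associative_orthonormal_basis_Un by blast
qed

end
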